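(* Let $(X,\tau,\mathscr M,m)$ be a topological measure space and let $AC(X)$ be the collection of all $\mathbb K$-valued absolutely continuous functions on $X$, where $\mathbb K$ is $\mathbb R$ or $\mathbb C$. Let $f,g\in AC(X)$. Then: (i) $f+g\in AC(X)$; (ii) $\alpha\cdot f\in AC(X)$ for all $\alpha\in\mathbb K$; (iii) $f\cdot g\in AC(X)$, provided $f$ and $g$ are both bounded functions; (iv) $\frac1f\in AC(X)$, if $|f|\ge K$ on $X$ for some $K>0$; (v) $|f|\in AC(X)$.
   Context: Let $(X,\tau)$ be a topological space and $(X,\mathscr M,m)$ a measure space. $(X,\tau,\mathscr M,m)$ is called a topological measure space (tms) if: (i) $\mathscr M$ contains all open sets of $(X,\tau)$; (ii) for every $x\in X$ and every $\varepsilon>0$ there exists an open connected neighbourhood $U$ of $x$ with $m(U)<\varepsilon$; (iii) for every $G\in\tau$ and every $x\in G$ there exists $\varepsilon>0$ such that every open connected neighbourhood $U$ of $x$ with $m(U)<\varepsilon$ satisfies $U\subseteq G$. For $\delta>0$, $\mathcal P_\delta$ denotes the collection of all countable (finite or infinite) families $\{E_i\}_i$ of pairwise disjoint open connected subsets of $X$ with $\sum_i m(E_i)<\delta$. A function $f:X\to\mathbb K$ is absolutely continuous if for every $\varepsilon>0$ there exists $\delta>0$ such that for every $\{D_i\}_i\in\mathcal P_\delta$ one has $\sum_i\omega(f,D_i)<\varepsilon$, where $\omega(f,D):=\sup\{|f(x)-f(y)|:x,y\in D\}$. *)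

theory Defs
  imports "HOL-Analysis.Analysis"
begin

text \<open>The underlying set is \<open>topspace T = space M\<close>; functions on it are total HOL functions whose
  values elsewhere play no role. "Neighbourhood" is always an open set containing the point.\<close>

locale topological_measure_space =
  fixes T :: "'a topology" and M :: "'a measure"
  assumes space_eq: "space M = topspace T"
    and open_measurable: "\<And>G. openin T G \<Longrightarrow> G \<in> sets M"
    and small_nbhd: "\<And>x \<epsilon>::real. x \<in> topspace T \<Longrightarrow> \<epsilon> > 0 \<Longrightarrow>
      \<exists>U. openin T U \<and> connectedin T U \<and> x \<in> U \<and> emeasure M U < ennreal \<epsilon>"
    and small_nbhd_subset: "\<And>G x. openin T G \<Longrightarrow> x \<in> G \<Longrightarrow>
      \<exists>\<epsilon>::real. \<epsilon> > 0 \<and>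
        (\<forall>U. openin T U \<and> connectedin T U \<and> x \<in> U \<and> emeasure M U < ennreal \<epsilon> \<longrightarrow> U \<subseteq> G)"

text \<open>The oscillation is taken in the extended nonnegative reals: it is \<open>\<infinity>\<close> when \<open>f\<close> is unbounded
  on \<open>D\<close>, and \<open>0\<close> on the empty set.\<close>

definition oscillation :: "('a \<Rightarrow> 'k::real_normed_field) \<Rightarrow> 'a set \<Rightarrow> ennreal" where
  "oscillation f D = (SUP (x, y) \<in> D \<times> D. ennreal (norm (f x - f y)))"

text \<open>A countable family is given by an index set \<open>I\<close> of naturals, finite or infinite, and a
  map \<open>E\<close>, relevant only on \<open>I\<close>.\<close>

definition small_families ::
    "'a topology \<Rightarrow> 'a measure \<Rightarrow> real \<Rightarrow> (nat set \<times> (nat \<Rightarrow> 'a set)) set" where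
  "small_families T M \<delta> = {(I, E).
     disjoint_family_on E I \<and>
     (\<forall>i\<in>I. openin T (E i) \<and> connectedin T (E i)) \<and>
     (\<Sum>\<^sub>\<infinity>i\<in>I. emeasure M (E i)) < ennreal \<delta>}"

text \<open>The scalars range over \<open>real_normed_field\<close>. As the norm of that class is multiplicative,
  its instances are, up to isometric isomorphism, exactly the real and the complex numbers.\<close>

definition AC :: "'a topology \<Rightarrow> 'a measure \<Rightarrow> ('a \<Rightarrow> 'k::real_normed_field) set" where
  "AC T M = {f. \<forall>\<epsilon>::real. \<epsilon> > 0 \<longrightarrow> (\<exists>\<delta>::real. \<delta> > 0 \<and>
     (\<forall>(I, D) \<in> small_families T M \<delta>. (\<Sum>\<^sub>\<infinity>i\<in>I. oscillation f (D i)) < ennreal \<epsilon>))}"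

end

theory Submission
  imports Defs
begin

text \<open>
  Each of the five functions \<open>h\<close> built from \<open>f\<close> and \<open>g\<close> varies at most proportionally to them:
  there is a constant \<open>C\<close> with
  \<open>norm (h x - h y) \<le> C * (norm (f x - f y) + norm (g x - g y))\<close> for all points \<open>x\<close>, \<open>y\<close>.
  Such a bound passes to oscillations over sets, hence to the sums of oscillations
  over a family, and so makes \<open>h\<close> absolutely continuous: a family that is small enough for
  both \<open>f\<close> and \<open>g\<close> at tolerance \<open>\<epsilon> / (2 * C)\<close> works for \<open>h\<close> at \<open>\<epsilon>\<close>. This transfer principle is
  \<open>AC_dominated\<close>; the rest is the elementary inequality for each operation. Boundedness supplies
  \<open>C\<close> for products, and the lower bound on \<open>norm (f x)\<close> supplies it for reciprocals.
\<close>

lemma oscillation_upper: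
  assumes "x \<in> D" "y \<in> D"
  shows "ennreal (norm (f x - f y)) \<le> oscillation f D"
  unfolding oscillation_def using assms by (intro SUP_upper2[of "(x, y)"]) auto

lemma oscillation_dominated:
  assumes C: "C \<ge> 0"
    and dom: "\<And>x y. x \<in> D \<Longrightarrow> y \<in> D \<Longrightarrow>
      norm (h x - h y) \<le> C * (norm (f x - f y) + norm (g x - g y))"
  shows "oscillation h D \<le> ennreal C * (oscillation f D + oscillation g D)"
proof -
  have "ennreal (norm (h x - h y)) \<le> ennreal C * (oscillation f D + oscillation g D)"
    if "x \<in> D" "y \<in> D" for x y
  proof -
    have "ennreal (norm (h x - h y)) \<le> ennreal (C * (norm (f x - f y) + norm (g x - g y)))"
      using dom that by (intro ennreal_leI)
    also have "\<dots> = ennreal C * (ennreal (norm (f x - f y)) + ennreal (norm (g x - g y)))"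
      using C by (simp add: ennreal_mult)
    also have "\<dots> \<le> ennreal C * (oscillation f D + oscillation g D)"
      using that by (intro mult_left_mono add_mono oscillation_upper) auto
    finally show ?thesis .
  qed
  then show ?thesis
    unfolding oscillation_def[of h] by (intro SUP_least) auto
qed

text \<open>
  Multiplication on \<open>ennreal\<close> is not jointly continuous (it fails at \<open>0 * \<infinity>\<close>), so the general
  rule for constant factors in topological semigroups does not apply. Multiplication by a fixed
  finite constant is continuous and additive, and therefore commutes with the infinite sum.
\<close>

lemma infsum_cmult_ennreal:
  fixes c :: ennreal
  assumes "c < top"
  shows "(\<Sum>\<^sub>\<infinity>i\<in>I. c * u i) = c * (\<Sum>\<^sub>\<infinity>i\<in>I. u i)"
proof -
  have "isCont ((*) c) (\<Sum>\<^sub>\<infinity>i\<in>I. u i)"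
    unfolding isCont_def using assms by (intro ennreal_tendsto_cmult tendsto_ident_at)
  then have "infsum ((*) c \<circ> u) I = c * infsum u I"
    by (intro infsum_comm_additive_general)
       (simp_all add: sum_distrib_left nonneg_summable_on_complete)
  then show ?thesis
    by (simp add: o_def)
qed

lemma small_families_mono:
  assumes "\<delta> \<le> \<delta>'"
  shows "small_families T M \<delta> \<subseteq> small_families T M \<delta>'"
  unfolding small_families_def using ennreal_leI[OF assms] by (auto intro: less_le_trans)

text \<open>
  Since the pointwise bound becomes a bound on sums of oscillations, each of the two summands may
  use up half of the tolerance \<open>\<epsilon> / C\<close>. With \<open>g = f\<close> this also covers operations on a single
  function.
\<close>

lemma AC_dominated:
  fixes f g h :: "'a \<Rightarrow> 'k::real_normed_field"
  assumes f: "f \<in> AC T M" and g: "g \<in> AC T M" and C: "C > 0"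
    and dom: "\<And>x y. x \<in> topspace T \<Longrightarrow> y \<in> topspace T \<Longrightarrow>
      norm (h x - h y) \<le> C * (norm (f x - f y) + norm (g x - g y))"
  shows "h \<in> AC T M"
  unfolding AC_def
proof (intro CollectI allI impI)
  fix \<epsilon> :: real
  assume \<epsilon>: "\<epsilon> > 0"
  define \<eta> where "\<eta> = \<epsilon> / (2 * C)"
  have \<eta>: "\<eta> > 0" "C * (\<eta> + \<eta>) = \<epsilon>"
    using \<epsilon> C by (auto simp: \<eta>_def)
  obtain \<delta>f where \<delta>f: "\<delta>f > 0"
    "\<forall>(I, D) \<in> small_families T M \<delta>f. (\<Sum>\<^sub>\<infinity>i\<in>I. oscillation f (D i)) < ennreal \<eta>"
    using f \<eta>(1) unfolding AC_def by blast
  obtain \<delta>g where \<delta>g: "\<delta>g > 0"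
    "\<forall>(I, D) \<in> small_families T M \<delta>g. (\<Sum>\<^sub>\<infinity>i\<in>I. oscillation g (D i)) < ennreal \<eta>"
    using g \<eta>(1) unfolding AC_def by blast
  have "(\<Sum>\<^sub>\<infinity>i\<in>I. oscillation h (D i)) < ennreal \<epsilon>"
    if ID: "(I, D) \<in> small_families T M (min \<delta>f \<delta>g)" for I D
  proof -
    let ?F = "\<Sum>\<^sub>\<infinity>i\<in>I. oscillation f (D i)" and ?G = "\<Sum>\<^sub>\<infinity>i\<in>I. oscillation g (D i)"
    have "(I, D) \<in> small_families T M \<delta>f" "(I, D) \<in> small_families T M \<delta>g"
      using ID small_families_mono[of "min \<delta>f \<delta>g"] by (meson min.cobounded1 min.cobounded2 subsetD)+
    then have FG: "?F < ennreal \<eta>" "?G < ennreal \<eta>"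
      using \<delta>f(2) \<delta>g(2) by auto
    have sub: "D i \<subseteq> topspace T" if "i \<in> I" for i
      using ID that unfolding small_families_def by (auto dest: openin_subset)
    have "(\<Sum>\<^sub>\<infinity>i\<in>I. oscillation h (D i))
        \<le> (\<Sum>\<^sub>\<infinity>i\<in>I. ennreal C * (oscillation f (D i) + oscillation g (D i)))"
    proof (rule infsum_mono)
      fix i
      assume "i \<in> I"
      then show "oscillation h (D i) \<le> ennreal C * (oscillation f (D i) + oscillation g (D i))"
        using C by (intro oscillation_dominated dom) (auto dest: sub)
    qed (simp_all add: nonneg_summable_on_complete)
    also have "\<dots> = ennreal C * (?F + ?G)"
      by (simp add: infsum_cmult_ennreal infsum_add nonneg_summable_on_complete)
    also have "\<dots> < ennreal C * (ennreal \<eta> + ennreal \<eta>)"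
      using C FG by (intro ennreal_mult_strict_left_mono add_strict_mono) auto
    also have "\<dots> = ennreal \<epsilon>"
      using C \<eta> by (simp flip: ennreal_plus ennreal_mult)
    finally show ?thesis .
  qed
  then show "\<exists>\<delta>>0. \<forall>(I, D) \<in> small_families T M \<delta>. (\<Sum>\<^sub>\<infinity>i\<in>I. oscillation h (D i)) < ennreal \<epsilon>"
    using \<delta>f(1) \<delta>g(1) by (intro exI[of _ "min \<delta>f \<delta>g"]) auto
qed

lemma AC_add:
  assumes "f \<in> AC T M" "g \<in> AC T M"
  shows "(\<lambda>x. f x + g x) \<in> AC T M"
proof (rule AC_dominated[OF assms, of 1])
  fix x y
  show "norm (f x + g x - (f y + g y)) \<le> 1 * (norm (f x - f y) + norm (g x - g y))"
    unfolding add_diff_add mult_1 by (rule norm_triangle_ineq)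
qed simp

lemma AC_cmult:
  assumes "f \<in> AC T M"
  shows "(\<lambda>x. \<alpha> * f x) \<in> AC T M"
  \<comment> \<open>The summand \<open>1\<close> keeps the constant positive when \<open>\<alpha> = 0\<close>.\<close>
proof (rule AC_dominated[OF assms assms, of "norm \<alpha> + 1"])
  fix x y
  have "norm (\<alpha> * f x - \<alpha> * f y) = norm \<alpha> * norm (f x - f y)"
    by (simp flip: norm_mult right_diff_distrib)
  also have "\<dots> \<le> (norm \<alpha> + 1) * (norm (f x - f y) + norm (f x - f y))"
    by (intro mult_mono) auto
  finally show "norm (\<alpha> * f x - \<alpha> * f y) \<le> (norm \<alpha> + 1) * (norm (f x - f y) + norm (f x - f y))" .
qed (simp add: add_nonneg_pos)

lemma AC_mult_bounded:
  fixes f g :: "'a \<Rightarrow> 'k::real_normed_field"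
  assumes f: "f \<in> AC T M" and g: "g \<in> AC T M"
    and bf: "bounded (f ` topspace T)" and bg: "bounded (g ` topspace T)"
  shows "(\<lambda>x. f x * g x) \<in> AC T M"
proof -
  have "bounded (f ` topspace T \<union> g ` topspace T)"
    using bf bg by simp
  then obtain B where B: "B > 0" "\<And>x. x \<in> topspace T \<Longrightarrow> norm (f x) \<le> B"
    "\<And>x. x \<in> topspace T \<Longrightarrow> norm (g x) \<le> B"
    by (auto simp: bounded_pos)
  show ?thesis
  proof (rule AC_dominated[OF f g B(1)])
    fix x y
    assume xy: "x \<in> topspace T" "y \<in> topspace T"
    have "f x * g x - f y * g y = f x * (g x - g y) + (f x - f y) * g y"
      by (simp add: algebra_simps)
    then have "norm (f x * g x - f y * g y)
        \<le> norm (f x) * norm (g x - g y) + norm (f x - f y) * norm (g y)"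
      by (metis norm_mult norm_triangle_ineq)
    also have "\<dots> \<le> B * norm (g x - g y) + norm (f x - f y) * B"
      using B xy by (intro add_mono mult_mono) auto
    finally show "norm (f x * g x - f y * g y) \<le> B * (norm (f x - f y) + norm (g x - g y))"
      by (simp add: algebra_simps)
  qed
qed

lemma AC_reciprocal:
  fixes f :: "'a \<Rightarrow> 'k::real_normed_field"
  assumes f: "f \<in> AC T M" and K: "K > 0" "\<And>x. x \<in> topspace T \<Longrightarrow> norm (f x) \<ge> K"
  shows "(\<lambda>x. 1 / f x) \<in> AC T M"
proof (rule AC_dominated[OF f f, of "1 / (K * K)"])
  fix x y
  assume xy: "x \<in> topspace T" "y \<in> topspace T"
  then have nz: "f x \<noteq> 0" "f y \<noteq> 0"
    using K by force+
  then have "1 / f x - 1 / f y = (f y - f x) / (f x * f y)"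
    by (simp add: field_simps)
  then have "norm (1 / f x - 1 / f y) = norm (f x - f y) / (norm (f x) * norm (f y))"
    by (simp add: norm_divide norm_mult norm_minus_commute)
  also have "\<dots> \<le> (norm (f x - f y) + norm (f x - f y)) / (K * K)"
    using K xy by (intro frac_le mult_mono) auto
  finally show "norm (1 / f x - 1 / f y) \<le> 1 / (K * K) * (norm (f x - f y) + norm (f x - f y))"
    by simp
qed (use K in simp)

lemma AC_norm:
  fixes f :: "'a \<Rightarrow> 'k::real_normed_field"
  assumes "f \<in> AC T M"
  shows "(\<lambda>x. of_real (norm (f x)) :: 'k) \<in> AC T M"
proof (rule AC_dominated[OF assms assms, of 1])
  fix x y
  have "norm (of_real (norm (f x)) - of_real (norm (f y)) :: 'k) = \<bar>norm (f x) - norm (f y)\<bar>"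
    by (simp flip: of_real_diff)
  also have "\<dots> \<le> norm (f x - f y)"
    by (rule norm_triangle_ineq3)
  also have "\<dots> \<le> 1 * (norm (f x - f y) + norm (f x - f y))"
    by simp
  finally show "norm (of_real (norm (f x)) - of_real (norm (f y)) :: 'k)
      \<le> 1 * (norm (f x - f y) + norm (f x - f y))" .
qed simp

theorem theorem4p7:
  fixes T :: "'a topology" and M :: "'a measure"
    and f g :: "'a \<Rightarrow> 'k::real_normed_field"
  assumes "topological_measure_space T M"
    and "f \<in> AC T M" and "g \<in> AC T M"
  shows "(\<lambda>x. f x + g x) \<in> AC T M
    \<and> (\<forall>\<alpha>::'k. (\<lambda>x. \<alpha> * f x) \<in> AC T M)
    \<and> (bounded (f ` topspace T) \<and> bounded (g ` topspace T) \<longrightarrow> (\<lambda>x. f x * g x) \<in> AC T M)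
    \<and> ((\<exists>K::real. K > 0 \<and> (\<forall>x\<in>topspace T. norm (f x) \<ge> K)) \<longrightarrow> (\<lambda>x. 1 / f x) \<in> AC T M)
    \<and> (\<lambda>x. of_real (norm (f x)) :: 'k) \<in> AC T M"
proof (intro conjI allI impI; (elim exE conjE)?)
  show "(\<lambda>x. f x + g x) \<in> AC T M"
    by (rule AC_add[OF assms(2,3)])
  show "(\<lambda>x. \<alpha> * f x) \<in> AC T M" for \<alpha>
    by (rule AC_cmult[OF assms(2)])
  show "(\<lambda>x. f x * g x) \<in> AC T M" if "bounded (f ` topspace T)" "bounded (g ` topspace T)"
    by (rule AC_mult_bounded[OF assms(2,3) that])
  show "(\<lambda>x. 1 / f x) \<in> AC T M" if "K > 0" "\<forall>x\<in>topspace T. norm (f x) \<ge> K" for K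
    by (rule AC_reciprocal[OF assms(2) that(1)]) (use that(2) in blast)
  show "(\<lambda>x. of_real (norm (f x)) :: 'k) \<in> AC T M"
    by (rule AC_norm[OF assms(2)])
qed

end
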